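(* Let $\Delta t>0$, $\varepsilon>0$, $A\ge0$ and $A_0\ge A_0^\star:=\frac95\left(\frac2{15}\right)^{2/3}$. Given $\phi^{k}\in\mathcal{C}_{\rm per}$ with $\|\phi^k\|_\infty\le M_h$, $k=n,n-1$, for some $M_h>0$, and $\overline{\phi^{n}}=\overline{\phi^{n-1}}=\beta_0$ with $\beta_0>0$, there exists a unique solution $\phi^{n+1}\in\mathcal{C}_{\rm per}$ (with associated $\mu^{n+1}\in\mathcal{C}_{\rm per}$) of the scheme $$\frac{\frac32\phi^{n+1}-2\phi^n+\frac12\phi^{n-1}}{\Delta t}=\Delta_h\mu^{n+1},$$ $$\mu^{n+1}=-\frac83\left((\phi^{n+1})^{-9}-(\phi^{n+1})^{-3}\right)+\frac83A_0(\phi^{n+1}-\check\phi^{n+1})-A\,\Delta t\,\Delta_h(\phi^{n+1}-\phi^n)-\varepsilon^2\Delta_h\phi^{n+1},$$ where $\check\phi^{n+1}:=2\phi^n-\phi^{n-1}$, with $\phi^{n+1}-\phi^n\in\mathring{\mathcal{C}}_{\rm per}$ and $\phi^{n+1}>0$ at a point-wise level.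
   Context: Let $\Omega=(0,L)^3$, $L>0$, $N\in\mathbb{N}$, $h=L/N$. $\mathcal{C}_{\rm per}$ is the space of real grid functions $\upsilon=(\upsilon_{i,j,k})_{i,j,k\in\mathbb{Z}}$ that are $N$-periodic in each index, where $\upsilon_{i,j,k}=\upsilon(p_i,p_j,p_k)$, $p_i=(i-\tfrac12)h$. The mean is $\overline{\upsilon}=\frac{h^3}{|\Omega|}\sum_{i,j,k=1}^N\upsilon_{i,j,k}$, $\mathring{\mathcal{C}}_{\rm per}=\{\upsilon\in\mathcal{C}_{\rm per}:\overline\upsilon=0\}$, and $\|\upsilon\|_\infty=\max_{1\le i,j,k\le N}|\upsilon_{i,j,k}|$. The discrete Laplacian is $$\Delta_h\upsilon_{i,j,k}=\frac1{h^2}(\upsilon_{i+1,j,k}+\upsilon_{i-1,j,k}+\upsilon_{i,j+1,k}+\upsilon_{i,j-1,k}+\upsilon_{i,j,k+1}+\upsilon_{i,j,k-1}-6\upsilon_{i,j,k}).$$ Powers of grid functions are taken point-wise. *)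

theory Defs
  imports Complex_Main
begin

text \<open>
  A grid function is represented by its values at the cell centres
  \<open>(p\<^sub>i, p\<^sub>j, p\<^sub>k)\<close>, \<open>p\<^sub>i = (i - 1/2) h\<close>, indexed by integer triples;
  \<open>h = L / N\<close> is the mesh size.
\<close>

type_synonym grid_fun = "int \<Rightarrow> int \<Rightarrow> int \<Rightarrow> real"

definition mesh_size :: "real \<Rightarrow> nat \<Rightarrow> real" where
  "mesh_size L N = L / real N"

definition C_per :: "nat \<Rightarrow> grid_fun set" where
  "C_per N = {v. \<forall>i j k. v (i + int N) j k = v i j k
                       \<and> v i (j + int N) k = v i j k
                       \<and> v i j (k + int N) = v i j k}"

text \<open>The factor \<open>L ^ 3\<close> is the volume of \<open>\<Omega> = (0, L)\<^sup>3\<close>.\<close>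

definition grid_mean :: "real \<Rightarrow> nat \<Rightarrow> grid_fun \<Rightarrow> real" where
  "grid_mean L N v =
     mesh_size L N ^ 3 / L ^ 3
       * (\<Sum>i = 1..int N. \<Sum>j = 1..int N. \<Sum>k = 1..int N. v i j k)"

definition C_per_mean_zero :: "real \<Rightarrow> nat \<Rightarrow> grid_fun set" where
  "C_per_mean_zero L N = {v \<in> C_per N. grid_mean L N v = 0}"

text \<open>Only meaningful for \<open>N \<ge> 1\<close>, where the maximum is over a nonempty finite set.\<close>

definition grid_max_norm :: "nat \<Rightarrow> grid_fun \<Rightarrow> real" where
  "grid_max_norm N v =
     Max {\<bar>v i j k\<bar> | i j k. i \<in> {1..int N} \<and> j \<in> {1..int N} \<and> k \<in> {1..int N}}"

definition disc_laplacian :: "real \<Rightarrow> grid_fun \<Rightarrow> grid_fun" where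
  "disc_laplacian h v = (\<lambda>i j k.
     1 / h ^ 2 * (v (i + 1) j k + v (i - 1) j k
                + v i (j + 1) k + v i (j - 1) k
                + v i j (k + 1) + v i j (k - 1) - 6 * v i j k))"

end

theory Submission
  imports Defs "HOL-Analysis.Function_Topology"
begin

text \<open>
  One step of the scheme is a gradient flow step for a convex energy, and the solution is
  obtained from a minimiser of a functional on a finite-dimensional space. With
  \<open>r = 2 / 3 * (2 * \<phi>n - \<phi>p / 2)\<close>, \<open>\<tau> = 2 / 3 * \<Delta>t\<close> and \<open>\<kappa> = A * \<Delta>t + \<epsilon>\<^sup>2\<close> the
  scheme reads
  \<open>\<phi> = r + \<tau> * \<Delta>\<^sub>h \<mu>\<close> and \<open>\<mu> = G \<phi> - q - \<kappa> * \<Delta>\<^sub>h \<phi>\<close>, where \<open>G\<close> is the sum of the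
  Lennard-Jones force and the stabilising term, and \<open>q\<close> is given by the two old steps. The mass
  of \<open>\<phi>\<close> equals that of \<open>r\<close>, which is the positive mass of the data.

  Existence (\<open>implicit_step_exists\<close>): write \<open>\<phi> = r + \<tau> * \<Delta>\<^sub>h \<psi>\<close> and minimise the Dirichlet
  energy of \<open>\<psi>\<close> plus the free energy of \<open>\<phi>\<close> over all \<open>\<psi>\<close> with \<open>\<phi> > 0\<close>. The free energy blows
  up as a value of \<open>\<phi>\<close> tends to zero, because the potential contains the power
  \<open>\<phi>\<^bsup>-8\<^esup>\<close>; so the minimum is attained inside the admissible set, and there the
  Euler-Lagrange equation is the scheme. That the admissible set is not empty is the solvability of the
  discrete Poisson equation (\<open>poisson\<close>), which makes the constant density available.

  Uniqueness (\<open>implicit_step_unique\<close>): test the difference of two solutions with the difference of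
  their potentials. Both sides have a sign as soon as \<open>G\<close> is monotone, and the bound on
  \<open>A\<^sub>0\<close> is exactly what makes it so (\<open>convex_force_mono\<close>).

  The arguments use the discrete Laplacian only through summation by parts and
  connectedness. They are therefore carried out for the Laplacian of a finite connected
  weighted graph, and the periodic grid is then shown to be one.
\<close>

section \<open>Laplacians of finite connected weighted graphs\<close>

text \<open>
  Tychonoff's theorem. It lets functions on the vertices be minimised over in the plain
  function type, with no reference to a Euclidean space of varying dimension.
\<close>

lemma compact_pointwise:
  fixes S :: "'v \<Rightarrow> 'a::topological_space set"
  assumes "\<And>x. compact (S x)"
  shows "compact {f. \<forall>x. f x \<in> S x}"
proof -
  have "compactin (product_topology (\<lambda>_. euclidean) UNIV) (PiE UNIV S)"
    using assms by (simp add: compactin_PiE)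
  then have "compact (PiE UNIV S)"
    by (simp add: euclidean_product_topology)
  moreover have "PiE UNIV S = {f. \<forall>x. f x \<in> S x}"
    by (auto simp: PiE_def Pi_def)
  ultimately show ?thesis by simp
qed

text \<open>
  Loops are permitted, as they contribute nothing to the Laplacian, and weights can count multiple
  edges. This admits the periodic grids with one or two cells per direction, where a cell is its
  own neighbour or meets the same neighbour on both sides.
\<close>

locale weighted_graph =
  fixes V :: "'v set" and w :: "'v \<Rightarrow> 'v \<Rightarrow> real"
  assumes finite_V: "finite V" and V_nonempty: "V \<noteq> {}"
    and w_nonneg: "\<And>x y. w x y \<ge> 0"
    and w_sym: "\<And>x y. x \<in> V \<Longrightarrow> y \<in> V \<Longrightarrow> w x y = w y x"
    and connected: "\<And>x y. x \<in> V \<Longrightarrow> y \<in> V \<Longrightarrow>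
      (x, y) \<in> {(x, y). x \<in> V \<and> y \<in> V \<and> w x y > 0}\<^sup>*"
begin

definition lap :: "('v \<Rightarrow> real) \<Rightarrow> 'v \<Rightarrow> real" where
  "lap f x = (\<Sum>y\<in>V. w x y * (f y - f x))"

text \<open>
  The Dirichlet form; the factor one half makes up for counting each edge in both directions.
\<close>

definition dform :: "('v \<Rightarrow> real) \<Rightarrow> ('v \<Rightarrow> real) \<Rightarrow> real" where
  "dform f g = (\<Sum>x\<in>V. \<Sum>y\<in>V. w x y * (f x - f y) * (g x - g y)) / 2"

lemma lap_cong: "x \<in> V \<Longrightarrow> (\<And>y. y \<in> V \<Longrightarrow> f y = g y) \<Longrightarrow> lap f x = lap g x"
  unfolding lap_def by (intro sum.cong) auto

lemma dform_cong:
  assumes "\<And>x y. x \<in> V \<Longrightarrow> y \<in> V \<Longrightarrow> f x - f y = f' x - f' y"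
    and "\<And>x y. x \<in> V \<Longrightarrow> y \<in> V \<Longrightarrow> g x - g y = g' x - g' y"
  shows "dform f g = dform f' g'"
  unfolding dform_def using assms by (simp cong: sum.cong)

lemma lap_add: "lap (\<lambda>x. f x + g x) x = lap f x + lap g x"
  unfolding lap_def by (simp flip: sum.distrib) (simp add: algebra_simps)

lemma lap_cmult: "lap (\<lambda>x. c * f x) x = c * lap f x"
  unfolding lap_def by (simp add: sum_distrib_left algebra_simps)

lemma lap_diff: "lap (\<lambda>x. f x - g x) x = lap f x - lap g x"
  unfolding lap_def by (simp flip: sum_subtractf) (simp add: algebra_simps)

text \<open>
  Summation by parts: exchanging the two summation indices and using the symmetry of the
  weights antisymmetrises the double sum.
\<close>

lemma sum_mult_lap: "(\<Sum>x\<in>V. f x * lap g x) = - dform f g"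
proof -
  let ?S = "\<Sum>x\<in>V. f x * lap g x"
  have 1: "?S = (\<Sum>x\<in>V. \<Sum>y\<in>V. w x y * f x * (g y - g x))"
    unfolding lap_def by (simp add: sum_distrib_left algebra_simps)
  also have "\<dots> = (\<Sum>y\<in>V. \<Sum>x\<in>V. w x y * f x * (g y - g x))"
    by (rule sum.swap)
  also have "\<dots> = (\<Sum>x\<in>V. \<Sum>y\<in>V. w x y * f y * (g x - g y))"
    by (intro sum.cong) (auto simp: w_sym)
  finally have "2 * ?S = (\<Sum>x\<in>V. \<Sum>y\<in>V. w x y * f x * (g y - g x) + w x y * f y * (g x - g y))"
    using 1 by (simp add: sum.distrib)
  also have "\<dots> = - 2 * dform f g"
    unfolding dform_def by (simp flip: sum_negf) (simp add: algebra_simps)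
  finally show ?thesis by simp
qed

lemma dform_sym: "dform f g = dform g f"
  unfolding dform_def by (simp add: mult.commute mult.left_commute)

lemma sum_lap_mult: "(\<Sum>x\<in>V. lap f x * g x) = (\<Sum>x\<in>V. f x * lap g x)"
  using sum_mult_lap[of g f] sum_mult_lap[of f g] dform_sym[of f g] by (simp add: mult.commute)

lemma sum_lap: "(\<Sum>x\<in>V. lap f x) = 0"
  using sum_mult_lap[of "\<lambda>_. 1" f] by (simp add: dform_def)

lemma dform_nonneg: "dform f f \<ge> 0"
proof -
  have "w x y * (f x - f y) * (f x - f y) \<ge> 0" for x y
    using w_nonneg by (simp add: mult.assoc)
  then show ?thesis unfolding dform_def by (simp add: sum_nonneg)
qed

lemma edge_le_dform:
  assumes "x \<in> V" "y \<in> V"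
  shows "w x y * (f x - f y)\<^sup>2 \<le> 2 * dform f f"
proof -
  have nn: "w x y * (f x - f y) * (f x - f y) \<ge> 0" for x y
    using w_nonneg by (simp add: mult.assoc)
  have "w x y * (f x - f y)\<^sup>2 \<le> (\<Sum>y\<in>V. w x y * (f x - f y) * (f x - f y))"
    using member_le_sum[of y V "\<lambda>y. w x y * (f x - f y) * (f x - f y)"] nn finite_V assms
    by (simp add: power2_eq_square mult.assoc)
  also have "\<dots> \<le> 2 * dform f f"
    unfolding dform_def
    using member_le_sum[of x V "\<lambda>x. \<Sum>y\<in>V. w x y * (f x - f y) * (f x - f y)"] nn finite_V assms
    by (simp add: sum_nonneg)
  finally show ?thesis .
qed

lemma lap_eq_0_if_dform_eq_0:
  assumes "dform f f = 0" "x \<in> V"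
  shows "lap f x = 0"
proof -
  have "w x y * (f y - f x) = 0" if "y \<in> V" for y
  proof -
    have "w x y * (f x - f y)\<^sup>2 \<le> 0"
      using edge_le_dform[OF \<open>x \<in> V\<close> that, of f] assms by simp
    moreover have "w x y * (f x - f y)\<^sup>2 \<ge> 0"
      using w_nonneg by simp
    ultimately show ?thesis by auto
  qed
  then show ?thesis unfolding lap_def by (intro sum.neutral) blast
qed

text \<open>
  A discrete Poincare inequality, pointwise and anchored at one vertex. Each edge of positive
  weight bounds the difference of the values at its ends by a multiple of the square root of
  the energy; a path from the anchor adds up finitely many such bounds.
\<close>

lemma poincare:
  assumes "a \<in> V"
  obtains K where "\<And>x. K x \<ge> 0"
    and "\<And>x f. x \<in> V \<Longrightarrow> \<bar>f x - f a\<bar> \<le> K x * sqrt (dform f f)"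
proof -
  let ?E = "{(x, y). x \<in> V \<and> y \<in> V \<and> w x y > 0}"
  have "\<exists>K\<ge>0. \<forall>f. \<bar>f x - f a\<bar> \<le> K * sqrt (dform f f)" if "x \<in> V" for x
    using connected[OF \<open>a \<in> V\<close> that]
  proof induction
    case base
    show ?case by (intro exI[of _ 0]) auto
  next
    case (step y z)
    then obtain K where K: "K \<ge> 0" "\<And>f. \<bar>f y - f a\<bar> \<le> K * sqrt (dform f f)" by blast
    let ?C = "sqrt (2 / w y z)"
    from step have yz: "y \<in> V" "z \<in> V" "w y z > 0" by auto
    have "\<bar>f z - f a\<bar> \<le> (K + ?C) * sqrt (dform f f)" for f
    proof -
      have "(f y - f z)\<^sup>2 \<le> 2 / w y z * dform f f"
        using edge_le_dform[OF yz(1,2), of f] yz(3) by (simp add: field_simps)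
      then have "\<bar>f y - f z\<bar> \<le> ?C * sqrt (dform f f)"
        by (metis real_sqrt_abs real_sqrt_le_mono real_sqrt_mult)
      with K(2)[of f] show ?thesis by (simp add: algebra_simps)
    qed
    then show ?case
      using K(1) yz(3) by (intro exI[of _ "K + ?C"]) auto
  qed
  then obtain K where "\<And>x. x \<in> V \<Longrightarrow> K x \<ge> 0 \<and> (\<forall>f. \<bar>f x - f a\<bar> \<le> K x * sqrt (dform f f))"
    by metis
  then show ?thesis
    by (intro that[of "\<lambda>x. if x \<in> V then K x else 0"]) auto
qed

lemma continuous_on_lap: "continuous_on S (\<lambda>f. lap f x)"
  unfolding lap_def by (intro continuous_intros continuous_on_subset[OF continuous_on_product_coordinates]) auto

lemma continuous_on_dform:
  assumes "\<And>x. x \<in> V \<Longrightarrow> continuous_on S (\<lambda>f. F f x)"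
  shows "continuous_on S (\<lambda>f. dform (F f) (F f))"
  unfolding dform_def by (intro continuous_intros assms) auto

lemma dform_line:
  "dform (\<lambda>x. f x + t * g x) (\<lambda>x. f x + t * g x) = dform f f + 2 * t * dform f g + t\<^sup>2 * dform g g"
proof -
  have "dform (\<lambda>x. f x + t * g x) (\<lambda>x. f x + t * g x) =
    (\<Sum>x\<in>V. \<Sum>y\<in>V. w x y * (f x - f y) * (f x - f y) + 2 * t * (w x y * (f x - f y) * (g x - g y))
       + t\<^sup>2 * (w x y * (g x - g y) * (g x - g y))) / 2"
    unfolding dform_def by (intro arg_cong[where f="\<lambda>x. x / 2"] sum.cong) (auto simp: power2_eq_square algebra_simps)
  also have "\<dots> = dform f f + 2 * t * dform f g + t\<^sup>2 * dform g g"
    unfolding dform_def by (simp only: sum.distrib flip: sum_distrib_left) (simp add: field_simps)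
  finally show ?thesis .
qed

lemma dform_line_deriv:
  "((\<lambda>t. dform (\<lambda>x. f x + t * g x) (\<lambda>x. f x + t * g x)) has_real_derivative 2 * dform f g) (at 0)"
  unfolding dform_line by (auto intro!: derivative_eq_intros)

lemma eq_0_if_orthogonal:
  assumes "\<And>g. (\<Sum>x\<in>V. g x * u x) = 0" "x \<in> V"
  shows "u x = (0::real)"
  using assms(1)[of "\<lambda>y. of_bool (y = x)"] assms(2) finite_V by simp

text \<open>
  The Dirichlet principle: \<open>f\<close> minimises \<open>dform f f / 2 + (\<Sum>x\<in>V. g x * f x)\<close>, whose first
  variation in direction \<open>h\<close> is \<open>\<Sum>x\<in>V. h x * (g x - lap f x)\<close>. As the sum of \<open>g\<close> vanishes,
  the functional ignores additive constants, so a competitor may be normalised to vanish at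
  the anchor. If its value is negative, hence below that of zero, the Poincare inequality puts it
  into a fixed compact box; so a minimum over that box is a global one.
\<close>

lemma poisson:
  assumes g: "(\<Sum>x\<in>V. g x) = 0"
  obtains f where "\<And>x. x \<in> V \<Longrightarrow> lap f x = g x"
proof -
  obtain a where a: "a \<in> V" using V_nonempty by blast
  obtain K where K0: "\<And>x. K x \<ge> 0"
    and K: "\<And>x f. x \<in> V \<Longrightarrow> \<bar>f x - f a\<bar> \<le> K x * sqrt (dform f f)"
    using poincare[OF a] by blast
  define J where "J f = dform f f / 2 + (\<Sum>x\<in>V. g x * f x)" for f
  (* With the linear term bounded by M * sqrt D, where D is the energy, a negative value
     D / 2 - M * sqrt D forces sqrt D < 2 * M; this fixes the size of the box. *)
  define M where "M = (\<Sum>x\<in>V. \<bar>g x\<bar> * K x)"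
  have M: "M \<ge> 0" unfolding M_def using K0 by (simp add: sum_nonneg)
  define C where "C = {f. \<forall>x. f x \<in> {- (K x * (2 * M))..K x * (2 * M)}}"
  have "compact C" unfolding C_def by (rule compact_pointwise) simp
  moreover have 0: "(\<lambda>_. 0) \<in> C"
    unfolding C_def using K0 M by simp
  moreover have "continuous_on C J"
    unfolding J_def
    by (intro continuous_intros continuous_on_dform continuous_on_subset[OF continuous_on_product_coordinates]) auto
  ultimately obtain f where f: "f \<in> C" "\<And>h. h \<in> C \<Longrightarrow> J f \<le> J h"
    using continuous_attains_inf[of C J] by blast
  have min: "J f \<le> J h" for h
  proof (rule ccontr)
    assume neg: "\<not> J f \<le> J h"
    define h' where "h' x = (if x \<in> V then h x - h a else 0)" for x
    have D: "dform h' h' = dform h h"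
      by (rule dform_cong) (auto simp: h'_def)
    have "(\<Sum>x\<in>V. g x * h' x) = (\<Sum>x\<in>V. g x * h x) - (\<Sum>x\<in>V. g x) * h a"
      by (simp add: h'_def algebra_simps sum_subtractf sum_distrib_left)
    then have J: "J h' = J h" by (simp add: J_def D g)
    have "J h < 0"
      using neg f(2)[OF 0] by (simp add: J_def dform_def)
    have hb: "\<bar>h' x\<bar> \<le> K x * sqrt (dform h h)" for x
      using K[of x h] K0[of x] by (auto simp: h'_def dform_nonneg)
    have "- (\<Sum>x\<in>V. g x * h' x) \<le> M * sqrt (dform h h)"
      unfolding M_def sum_distrib_right sum_negf[symmetric]
    proof (rule sum_mono)
      fix x
      have "- (g x * h' x) \<le> \<bar>g x\<bar> * \<bar>h' x\<bar>" by (simp flip: abs_mult)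
      also have "\<dots> \<le> \<bar>g x\<bar> * (K x * sqrt (dform h h))"
        using hb by (intro mult_left_mono) auto
      finally show "- (g x * h' x) \<le> \<bar>g x\<bar> * K x * sqrt (dform h h)" by (simp add: mult.assoc)
    qed
    with \<open>J h < 0\<close> J have "sqrt (dform h h) * sqrt (dform h h) < 2 * M * sqrt (dform h h)"
      by (simp add: J_def D dform_nonneg)
    then have "sqrt (dform h h) \<le> 2 * M"
      using dform_nonneg[of h]
      by (metis less_eq_real_def mult_right_less_imp_less real_sqrt_ge_zero)
    then have "\<bar>h' x\<bar> \<le> K x * (2 * M)" for x
      using hb[of x] K0[of x] by (meson mult_left_mono order_trans)
    then have "h' \<in> C" unfolding C_def by (auto simp: abs_le_iff minus_le_iff)
    with f(2) J neg show False by metis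
  qed
  have orth: "(\<Sum>x\<in>V. h x * (g x - lap f x)) = 0" for h
  proof -
    have "((\<lambda>t. J (\<lambda>x. f x + t * h x)) has_real_derivative
        2 * dform f h / 2 + (\<Sum>x\<in>V. g x * h x)) (at 0)"
      unfolding J_def
      by (intro derivative_intros DERIV_sum dform_line_deriv[THEN DERIV_cdivide])
         (auto intro!: derivative_eq_intros)
    then have "2 * dform f h / 2 + (\<Sum>x\<in>V. g x * h x) = 0"
      by (rule DERIV_local_min[OF _ zero_less_one]) (simp add: min)
    moreover have "(\<Sum>x\<in>V. h x * lap f x) = - dform f h"
      by (simp add: sum_mult_lap dform_sym)
    ultimately show ?thesis
      by (simp add: algebra_simps sum_subtractf)
  qed
  show ?thesis
    using eq_0_if_orthogonal[OF orth] by (intro that[of f]) auto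
qed

section \<open>An implicit time step on a graph\<close>

text \<open>
  For the differences \<open>d\<close> of the densities and \<open>e\<close> of the potentials, \<open>d = \<tau> * lap e\<close> gives
  \<open>(\<Sum>x\<in>V. d x * e x) = - \<tau> * dform e e\<close>, while the equation for \<open>e\<close> and monotonicity of \<open>G\<close>
  give \<open>(\<Sum>x\<in>V. d x * e x) \<ge> \<kappa> * dform d d\<close>. Hence \<open>e\<close> has no energy, so \<open>lap e\<close> vanishes
  on \<open>V\<close>, and so does \<open>d\<close>.
\<close>

theorem implicit_step_unique:
  fixes G :: "real \<Rightarrow> real"
  assumes "\<tau> > 0" "\<kappa> \<ge> 0"
    and mono: "\<And>s t. 0 < s \<Longrightarrow> s \<le> t \<Longrightarrow> G s \<le> G t"
    and 1: "\<And>x. x \<in> V \<Longrightarrow> f x > 0 \<and> f x = r x + \<tau> * lap m x \<and> m x = G (f x) - q x - \<kappa> * lap f x"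
    and 2: "\<And>x. x \<in> V \<Longrightarrow> f' x > 0 \<and> f' x = r x + \<tau> * lap m' x \<and> m' x = G (f' x) - q x - \<kappa> * lap f' x"
    and "x \<in> V"
  shows "f x = f' x"
proof -
  define d where "d x = f x - f' x" for x
  define e where "e x = m x - m' x" for x
  have d: "d x = \<tau> * lap e x" if "x \<in> V" for x
    using 1[OF that] 2[OF that] by (simp add: d_def e_def[abs_def] lap_diff algebra_simps)
  have e: "e x = G (f x) - G (f' x) - \<kappa> * lap d x" if "x \<in> V" for x
  proof -
    have "lap d x = lap f x - lap f' x" by (simp add: d_def[abs_def] lap_diff)
    with 1[OF that] 2[OF that] show ?thesis
      unfolding e_def by (simp only: right_diff_distrib)
  qed
  have "0 \<le> (\<Sum>x\<in>V. d x * (G (f x) - G (f' x)))"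
  proof (rule sum_nonneg)
    fix x assume "x \<in> V"
    then have "f x > 0" "f' x > 0" using 1 2 by blast+
    then show "0 \<le> d x * (G (f x) - G (f' x))"
      using mono[of "f x" "f' x"] mono[of "f' x" "f x"]
      by (cases "f x \<le> f' x") (auto simp: d_def zero_le_mult_iff)
  qed
  also have "\<dots> = (\<Sum>x\<in>V. d x * e x + \<kappa> * (d x * lap d x))"
    by (intro sum.cong) (auto simp: e algebra_simps)
  also have "\<dots> = (\<Sum>x\<in>V. d x * e x) - \<kappa> * dform d d"
    by (simp add: sum.distrib sum_mult_lap flip: sum_distrib_left)
  also have "(\<Sum>x\<in>V. d x * e x) = (\<Sum>x\<in>V. \<tau> * (e x * lap e x))"
    by (intro sum.cong) (auto simp: d)
  also have "\<dots> = - \<tau> * dform e e"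
    by (simp add: sum_mult_lap flip: sum_distrib_left)
  finally have "\<tau> * dform e e + \<kappa> * dform d d \<le> 0" by simp
  then have "dform e e = 0"
    using \<open>\<tau> > 0\<close> \<open>\<kappa> \<ge> 0\<close> dform_nonneg[of e] dform_nonneg[of d]
    by (smt (verit) mult_nonneg_nonneg mult_pos_pos)
  with lap_eq_0_if_dform_eq_0 \<open>x \<in> V\<close> d[of x] show ?thesis
    by (simp add: d_def)
qed

text \<open>
  The density is sought in the form \<open>P \<psi> = r + \<tau> * lap \<psi>\<close>, which fixes its total mass. Let \<open>J\<close>
  be the energy \<open>\<tau> / 2 * dform \<psi> \<psi>\<close> plus the free energy of \<open>P \<psi>\<close>. Its first variation
  in direction \<open>\<eta>\<close> is \<open>\<tau> * (\<Sum>x\<in>V. \<eta> x * (lap m x - lap \<psi> x))\<close>, where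
  \<open>m = G (P \<psi>) - q - \<kappa> * lap (P \<psi>)\<close>. So at a minimiser \<open>lap m = lap \<psi>\<close>, and
  \<open>P \<psi> = r + \<tau> * lap m\<close> is the equation to be solved. Up to a factor, \<open>dform \<psi> \<psi>\<close> is the squared
  negative norm of \<open>P \<psi> - r\<close> in the usual gradient flow formulation; taking \<open>\<psi>\<close> as the unknown
  avoids inverting the Laplacian inside the functional.

  A minimiser exists and keeps \<open>P \<psi>\<close> positive: positive densities of given mass are bounded,
  so all terms of \<open>J\<close> are bounded below. Hence a bound on \<open>J\<close> bounds the energy of \<open>\<psi>\<close>, which
  by the Poincare inequality bounds \<open>\<psi>\<close> up to a constant, and it bounds each \<open>\<Gamma> (P \<psi> x)\<close>,
  which by the blow-up of \<open>\<Gamma>\<close> keeps \<open>P \<psi> x\<close> away from zero.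
\<close>

theorem implicit_step_exists:
  fixes G \<Gamma> :: "real \<Rightarrow> real"
  assumes "\<tau> > 0" "\<kappa> \<ge> 0"
    and deriv: "\<And>s. s > 0 \<Longrightarrow> (\<Gamma> has_real_derivative G s) (at s)"
    and lower: "\<And>s. s > 0 \<Longrightarrow> \<gamma> \<le> \<Gamma> s"
    and blowup: "filterlim \<Gamma> at_top (at_right 0)"
    and r: "(\<Sum>x\<in>V. r x) > 0"
  shows "\<exists>f m. \<forall>x\<in>V. f x > 0 \<and> f x = r x + \<tau> * lap m x \<and> m x = G (f x) - q x - \<kappa> * lap f x"
proof -
  define P where "P \<psi> x = r x + \<tau> * lap \<psi> x" for \<psi> x
  define J where "J \<psi> = \<tau> / 2 * dform \<psi> \<psi> + (\<Sum>x\<in>V. \<Gamma> (P \<psi> x) - q x * P \<psi> x)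
    + \<kappa> / 2 * dform (P \<psi>) (P \<psi>)" for \<psi>
  define R where "R = (\<Sum>x\<in>V. r x)"
  have card: "card V > 0" using finite_V V_nonempty by (simp add: card_gt_0_iff)
  have contP: "continuous_on S (\<lambda>\<psi>. P \<psi> x)" for S x
    unfolding P_def by (intro continuous_intros continuous_on_lap)
  (* A starting point with positive density: Poisson solvability reaches the constant density
     of the prescribed mass. *)
  obtain \<psi>\<^sub>0 where "\<And>x. x \<in> V \<Longrightarrow> lap \<psi>\<^sub>0 x = (R / card V - r x) / \<tau>"
    using poisson[of "\<lambda>x. (R / card V - r x) / \<tau>"] card
    by (auto simp: sum_subtractf R_def simp flip: sum_divide_distrib)
  then have P0: "P \<psi>\<^sub>0 x > 0" if "x \<in> V" for x
    using that \<open>\<tau> > 0\<close> r card by (simp add: P_def R_def)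
  obtain a where a: "a \<in> V" using V_nonempty by blast
  obtain K where K0: "\<And>x. K x \<ge> 0"
    and K: "\<And>x f. x \<in> V \<Longrightarrow> \<bar>f x - f a\<bar> \<le> K x * sqrt (dform f f)"
    using poincare[OF a] by blast
  (* Q is a lower bound of the sum of the pointwise free energies over positive densities of
     mass R, so that J psi - Q dominates each nonnegative part of J separately. *)
  define Q where "Q = (\<Sum>x\<in>V. \<gamma> - \<bar>q x\<bar> * R)"
  define D where "D = 2 * (J \<psi>\<^sub>0 - Q) / \<tau>"
  obtain \<delta> where \<delta>: "\<delta> > 0" "\<And>s. 0 < s \<Longrightarrow> s < \<delta> \<Longrightarrow> J \<psi>\<^sub>0 - Q + \<gamma> < \<Gamma> s"
    using blowup unfolding filterlim_at_top_dense eventually_at_right_field by blast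
  have bounds: "dform \<psi> \<psi> \<le> D \<and> (\<forall>x\<in>V. P \<psi> x \<ge> \<delta>)"
    if pos: "\<And>x. x \<in> V \<Longrightarrow> P \<psi> x > 0" and le: "J \<psi> \<le> J \<psi>\<^sub>0" for \<psi>
  proof -
    have "(\<Sum>x\<in>V. P \<psi> x) = R"
      by (simp add: P_def R_def sum.distrib sum_lap flip: sum_distrib_left)
    then have PR: "P \<psi> x \<le> R" if "x \<in> V" for x
      using member_le_sum[of x V "P \<psi>"] pos that finite_V by (simp add: less_imp_le)
    have qR: "q x * P \<psi> x \<le> \<bar>q x\<bar> * R" if "x \<in> V" for x
    proof -
      have "q x * P \<psi> x \<le> \<bar>q x\<bar> * P \<psi> x"
        using pos[OF that] by (intro mult_right_mono) auto
      also have "\<dots> \<le> \<bar>q x\<bar> * R" using PR[OF that] by (intro mult_left_mono) auto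
      finally show ?thesis .
    qed
    have low: "\<gamma> - \<bar>q x\<bar> * R \<le> \<Gamma> (P \<psi> x) - q x * P \<psi> x" if "x \<in> V" for x
      using lower[OF pos[OF that]] qR[OF that] by linarith
    have nn: "\<tau> / 2 * dform \<psi> \<psi> \<ge> 0" "\<kappa> / 2 * dform (P \<psi>) (P \<psi>) \<ge> 0"
      using \<open>\<tau> > 0\<close> \<open>\<kappa> \<ge> 0\<close> dform_nonneg by auto
    have "Q \<le> (\<Sum>x\<in>V. \<Gamma> (P \<psi> x) - q x * P \<psi> x)"
      unfolding Q_def by (rule sum_mono) (rule low)
    with nn le have "\<tau> / 2 * dform \<psi> \<psi> \<le> J \<psi>\<^sub>0 - Q" by (simp add: J_def)
    then have "dform \<psi> \<psi> \<le> D"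
      using \<open>\<tau> > 0\<close> by (simp add: D_def field_simps)
    moreover have "P \<psi> x \<ge> \<delta>" if x: "x \<in> V" for x
    proof (rule ccontr)
      assume "\<not> P \<psi> x \<ge> \<delta>"
      then have "J \<psi>\<^sub>0 - Q + \<gamma> < \<Gamma> (P \<psi> x)" using \<delta>(2)[of "P \<psi> x"] pos[OF x] by simp
      moreover have "(\<Gamma> (P \<psi> x) - q x * P \<psi> x) - (\<gamma> - \<bar>q x\<bar> * R)
          \<le> (\<Sum>x\<in>V. (\<Gamma> (P \<psi> x) - q x * P \<psi> x) - (\<gamma> - \<bar>q x\<bar> * R))"
        using low finite_V x
        by (intro member_le_sum[of x V "\<lambda>x. (\<Gamma> (P \<psi> x) - q x * P \<psi> x) - (\<gamma> - \<bar>q x\<bar> * R)"]) auto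
      moreover have "(\<Sum>x\<in>V. (\<Gamma> (P \<psi> x) - q x * P \<psi> x) - (\<gamma> - \<bar>q x\<bar> * R)) \<le> J \<psi>\<^sub>0 - Q"
        using nn le by (simp add: J_def Q_def sum_subtractf)
      ultimately show False using qR[OF x] by linarith
    qed
    ultimately show ?thesis by blast
  qed
  define b where "b x = K x * sqrt D" for x
  define C where "C = {\<psi>. \<forall>x. \<psi> x \<in> {- b x..b x}} \<inter> (\<Inter>x\<in>V. {\<psi>. \<delta> \<le> P \<psi> x})"
  have "compact C"
    unfolding C_def
    by (intro compact_Int_closed compact_pointwise closed_INT ballI closed_Collect_le
          continuous_on_const contP) auto
  have C_pos: "P \<psi> x > 0" if "\<psi> \<in> C" "x \<in> V" for \<psi> x
    using that \<delta>(1) by (force simp: C_def)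
  have cont: "continuous_on C J"
  proof -
    have "continuous_on C (\<lambda>\<psi>. \<Gamma> (P \<psi> x))" if "x \<in> V" for x
    proof (rule continuous_on_compose2[of "{0<..}" \<Gamma>, OF _ contP])
      show "continuous_on {0<..} \<Gamma>"
        using deriv by (intro continuous_at_imp_continuous_on) (auto intro: DERIV_isCont)
    qed (use C_pos that in auto)
    then show ?thesis
      unfolding J_def by (intro continuous_intros continuous_on_dform contP continuous_on_subset[OF continuous_on_product_coordinates]) auto
  qed
  have normalise: "\<exists>\<psi>'\<in>C. J \<psi>' = J \<psi>"
    if pos: "\<And>x. x \<in> V \<Longrightarrow> P \<psi> x > 0" and le: "J \<psi> \<le> J \<psi>\<^sub>0" for \<psi>
  proof -
    define \<psi>' where "\<psi>' x = (if x \<in> V then \<psi> x - \<psi> a else 0)" for x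
    have Deq: "dform \<psi>' \<psi>' = dform \<psi> \<psi>" by (rule dform_cong) (auto simp: \<psi>'_def)
    have Peq: "P \<psi>' x = P \<psi> x" if "x \<in> V" for x
      using that unfolding P_def lap_def by (auto simp: \<psi>'_def intro!: sum.cong)
    have "J \<psi>' = J \<psi>"
      unfolding J_def Deq using dform_cong[of "P \<psi>'" "P \<psi>" "P \<psi>'" "P \<psi>"] by (simp add: Peq)
    moreover have "\<bar>\<psi>' x\<bar> \<le> b x" for x
    proof -
      have "\<bar>\<psi>' x\<bar> \<le> K x * sqrt (dform \<psi> \<psi>)"
        using K[of x \<psi>] K0[of x] by (auto simp: \<psi>'_def dform_nonneg)
      also have "\<dots> \<le> b x"
        unfolding b_def using bounds[OF that] K0 by (intro mult_left_mono) auto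
      finally show ?thesis .
    qed
    then have "\<psi>' \<in> C"
      unfolding C_def using bounds[OF that] Peq by (auto simp: abs_le_iff minus_le_iff)
    ultimately show ?thesis by blast
  qed
  have "C \<noteq> {}" using normalise[OF P0] by blast
  with \<open>compact C\<close> cont obtain \<psi> where \<psi>: "\<psi> \<in> C" "\<And>\<eta>. \<eta> \<in> C \<Longrightarrow> J \<psi> \<le> J \<eta>"
    using continuous_attains_inf[of C J] by blast
  have min: "J \<psi> \<le> J \<eta>" if "\<And>x. x \<in> V \<Longrightarrow> P \<eta> x > 0" for \<eta>
  proof (cases "J \<eta> \<le> J \<psi>\<^sub>0")
    case True
    with normalise[OF that] \<psi>(2) show ?thesis by metis
  next
    case False
    moreover have "J \<psi> \<le> J \<psi>\<^sub>0" using normalise[OF P0] \<psi>(2) by force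
    ultimately show ?thesis by simp
  qed
  define f where "f = P \<psi>"
  define m where "m x = G (f x) - q x - \<kappa> * lap f x" for x
  have fpos: "f x > 0" if "x \<in> V" for x using C_pos \<psi>(1) that by (simp add: f_def)
  have orth: "(\<Sum>x\<in>V. \<eta> x * (lap m x - lap \<psi> x)) = 0" for \<eta>
  proof -
    define \<xi> where "\<xi> x = \<tau> * lap \<eta> x" for x
    have Pl: "P (\<lambda>x. \<psi> x + t * \<eta> x) = (\<lambda>x. f x + t * \<xi> x)" for t
      by (simp add: P_def f_def \<xi>_def lap_add lap_cmult algebra_simps fun_eq_iff)
    have "((\<lambda>t. J (\<lambda>x. \<psi> x + t * \<eta> x)) has_real_derivative
        \<tau> / 2 * (2 * dform \<psi> \<eta>) + (\<Sum>x\<in>V. G (f x) * \<xi> x - q x * \<xi> x) + \<kappa> / 2 * (2 * dform f \<xi>)) (at 0)"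
      unfolding J_def Pl
    proof (intro DERIV_add DERIV_sum DERIV_diff DERIV_cmult dform_line_deriv)
      fix x assume "x \<in> V"
      have line: "((\<lambda>t. f x + t * \<xi> x) has_real_derivative \<xi> x) (at 0)"
        by (auto intro!: derivative_eq_intros)
      then show "((\<lambda>t. f x + t * \<xi> x) has_real_derivative \<xi> x) (at 0)" .
      show "((\<lambda>t. \<Gamma> (f x + t * \<xi> x)) has_real_derivative G (f x) * \<xi> x) (at 0)"
        using DERIV_chain2[OF _ line, of \<Gamma> "G (f x)"] deriv[OF fpos[OF \<open>x \<in> V\<close>]] by simp
    qed
    (* Small perturbations keep the finitely many densities positive and so stay in competition. *)
    moreover
    have "\<forall>\<^sub>F t in nhds 0. \<forall>x\<in>V. f x + t * \<xi> x > 0"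
    proof (intro eventually_ball_finite finite_V ballI)
      fix x assume "x \<in> V"
      have "((\<lambda>t. f x + t * \<xi> x) \<longlongrightarrow> f x + 0 * \<xi> x) (nhds 0)"
        by (intro tendsto_intros filterlim_ident)
      then show "\<forall>\<^sub>F t in nhds 0. f x + t * \<xi> x > 0"
        using fpos[OF \<open>x \<in> V\<close>] by (simp add: order_tendsto_iff)
    qed
    then obtain d where d: "d > 0" "\<And>t x. \<bar>t\<bar> < d \<Longrightarrow> x \<in> V \<Longrightarrow> f x + t * \<xi> x > 0"
      unfolding eventually_nhds_metric by (auto simp: dist_real_def)
    then have "\<forall>t. \<bar>0 - t\<bar> < d \<longrightarrow> J (\<lambda>x. \<psi> x + 0 * \<eta> x) \<le> J (\<lambda>x. \<psi> x + t * \<eta> x)"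
      using min Pl by simp
    ultimately have "\<tau> / 2 * (2 * dform \<psi> \<eta>) + (\<Sum>x\<in>V. G (f x) * \<xi> x - q x * \<xi> x)
        + \<kappa> / 2 * (2 * dform f \<xi>) = 0"
      using DERIV_local_min[OF _ d(1)] by blast
    moreover have "dform f \<xi> = - (\<Sum>x\<in>V. \<xi> x * lap f x)"
      by (simp add: sum_mult_lap dform_sym)
    ultimately have "\<tau> * dform \<psi> \<eta> + (\<Sum>x\<in>V. \<xi> x * m x) = 0"
      by (simp add: m_def algebra_simps sum_subtractf sum.distrib sum_distrib_left)
    moreover have "(\<Sum>x\<in>V. \<xi> x * m x) = \<tau> * (\<Sum>x\<in>V. \<eta> x * lap m x)"
      by (simp add: \<xi>_def mult.assoc sum_lap_mult flip: sum_distrib_left)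
    moreover have "dform \<psi> \<eta> = - (\<Sum>x\<in>V. \<eta> x * lap \<psi> x)"
      by (simp add: sum_mult_lap dform_sym)
    ultimately have "\<tau> * (\<Sum>x\<in>V. \<eta> x * (lap m x - lap \<psi> x)) = 0"
      by (simp add: algebra_simps sum_subtractf)
    with \<open>\<tau> > 0\<close> show ?thesis by simp
  qed
  have "lap m x = lap \<psi> x" if "x \<in> V" for x
    using eq_0_if_orthogonal[OF orth that] by simp
  then show ?thesis
    using fpos by (intro exI[of _ f] exI[of _ m]) (auto simp: m_def f_def P_def)
qed

end

section \<open>The stabilised Lennard-Jones potential\<close>

text \<open>
  The Lennard-Jones type free energy density with the stabilising quadratic term included.
  Its derivative collects all terms of the chemical potential that depend pointwise on the
  new density.
\<close>

definition convex_potential :: "real \<Rightarrow> real \<Rightarrow> real" where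
  "convex_potential A\<^sub>0 s = 8 / 3 * (s powi (- 8) / 8 - s powi (- 2) / 2) + 4 / 3 * A\<^sub>0 * s\<^sup>2"

definition convex_force :: "real \<Rightarrow> real \<Rightarrow> real" where
  "convex_force A\<^sub>0 s = - (8 / 3) * (s powi (- 9) - s powi (- 3)) + 8 / 3 * A\<^sub>0 * s"

lemma convex_potential_deriv:
  assumes "s > 0"
  shows "(convex_potential A\<^sub>0 has_real_derivative convex_force A\<^sub>0 s) (at s)"
  unfolding convex_potential_def[abs_def] convex_force_def
  using assms by (auto intro!: derivative_eq_intros simp: algebra_simps)

text \<open>
  One bound serves twice: it makes the potential bounded below and makes it blow up at zero.
\<close>

lemma convex_potential_lower:
  assumes "s > 0" "A\<^sub>0 \<ge> 0"
  shows "(inverse s)\<^sup>2 - 5 \<le> convex_potential A\<^sub>0 s"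
proof -
  define u where "u = (inverse s)\<^sup>2"
  have u: "s powi (- 8) = u ^ 4" "s powi (- 2) = u"
    by (auto simp: u_def power_int_minus power_inverse simp flip: power_mult)
  (* The quadratic term only helps; three times the rest of the claim is
     u^4 - 7 u + 15 >= 0, a sum of squares plus a constant. *)
  have "0 \<le> (u\<^sup>2 - 2)\<^sup>2 + (2 * u - 7 / 4)\<^sup>2 + 127 / 16" by simp
  also have "\<dots> = u ^ 4 - 7 * u + 15"
    by (simp add: power2_eq_square power4_eq_xxxx algebra_simps)
  finally have "u - 5 \<le> 8 / 3 * (u ^ 4 / 8 - u / 2)" by simp
  moreover have "0 \<le> 4 / 3 * A\<^sub>0 * s\<^sup>2" using assms by simp
  ultimately show ?thesis
    unfolding convex_potential_def u u_def[symmetric] by linarith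
qed

lemma convex_potential_blowup:
  assumes "A\<^sub>0 \<ge> 0"
  shows "filterlim (convex_potential A\<^sub>0) at_top (at_right 0)"
proof (rule filterlim_at_top_mono)
  show "filterlim (\<lambda>s. - 5 + (inverse s)\<^sup>2) at_top (at_right (0 :: real))"
    by (intro filterlim_tendsto_add_at_top[OF tendsto_const] filterlim_pow_at_top
          filterlim_inverse_at_top_right) simp
  show "\<forall>\<^sub>F s in at_right 0. - 5 + (inverse s)\<^sup>2 \<le> convex_potential A\<^sub>0 s"
    using convex_potential_lower[OF _ assms] by (auto simp: eventually_at_right_field intro!: exI[of _ 1])
qed

text \<open>
  This is where the critical value of \<open>A\<^sub>0\<close> comes from. In \<open>u = x powi (- 2)\<close> the
  derivative of the force is a multiple of \<open>9 * u ^ 5 - 3 * u\<^sup>2 + A\<^sub>0\<close>, whose minimum over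
  \<open>u > 0\<close> lies at \<open>u = c\<close> with \<open>c ^ 3 = 2 / 15\<close> and equals \<open>A\<^sub>0 - 9 / 5 * c\<^sup>2\<close>.
\<close>

lemma convex_force_mono:
  assumes A: "A\<^sub>0 \<ge> 9 / 5 * (2 / 15) powr (2 / 3)" and "0 < s" "s \<le> t"
  shows "convex_force A\<^sub>0 s \<le> convex_force A\<^sub>0 t"
proof (rule DERIV_nonneg_imp_nondecreasing[OF \<open>s \<le> t\<close>])
  fix x assume "s \<le> x" "x \<le> t"
  with \<open>0 < s\<close> have x: "x > 0" by simp
  define c where "c = (2 / 15 :: real) powr (1 / 3)"
  have c: "c > 0" "c ^ 3 = 2 / 15" "(2 / 15) powr (2 / 3) = c\<^sup>2"
    by (auto simp: c_def powr_powr simp flip: powr_numeral)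
  define u where "u = x powi (- 2)"
  define y where "y = u / c"
  have "u > 0" "y > 0" using x c(1) by (auto simp: u_def y_def)
  have u: "x powi (- 10) = u ^ 5" "x powi (- 4) = u\<^sup>2"
    using power_int_mult[of x "-2" 5] power_int_mult[of x "-2" 2] by (auto simp: u_def)
  have "u = c * y" using c(1) by (simp add: y_def)
  (* With u = c * y the minimum moves to y = 1, a double root of
     2 y^5 - 5 y^2 + 3 = (y - 1)^2 (2 y^3 + 4 y^2 + 6 y + 3). *)
  have "0 \<le> 3 / 5 * c\<^sup>2 * ((y - 1)\<^sup>2 * (2 * y ^ 3 + 4 * y\<^sup>2 + 6 * y + 3))"
    using \<open>y > 0\<close> by simp
  also have "\<dots> = 9 * (c ^ 3 * c\<^sup>2 * y ^ 5) - 3 * (c\<^sup>2 * y\<^sup>2) + 9 / 5 * c\<^sup>2"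
    unfolding c(2) by algebra
  also have "\<dots> = 9 * u ^ 5 - 3 * u\<^sup>2 + 9 / 5 * c\<^sup>2"
    by (simp add: \<open>u = c * y\<close> power_mult_distrib flip: power_add)
  finally have "0 \<le> 9 * u ^ 5 - 3 * u\<^sup>2 + A\<^sub>0" using A c(3) by simp
  moreover have "(convex_force A\<^sub>0 has_real_derivative
      8 / 3 * (9 * x powi (- 10) - 3 * x powi (- 4) + A\<^sub>0)) (at x)"
    unfolding convex_force_def[abs_def]
    using x by (auto intro!: derivative_eq_intros simp: algebra_simps)
  ultimately show "\<exists>y. DERIV (convex_force A\<^sub>0) x :> y \<and> y \<ge> 0"
    unfolding u by (intro exI[of _ "8 / 3 * (9 * u ^ 5 - 3 * u\<^sup>2 + A\<^sub>0)"]) simp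
qed

section \<open>The periodic grid as a weighted graph\<close>

type_synonym grid_index = "int \<times> int \<times> int"

text \<open>
  The representative modulo \<open>N\<close> in \<open>{1..int N}\<close>, the index range used by the mean.
\<close>

definition wrap1 :: "nat \<Rightarrow> int \<Rightarrow> int" where
  "wrap1 N i = (i - 1) mod int N + 1"

definition wrap :: "nat \<Rightarrow> grid_index \<Rightarrow> grid_index" where
  "wrap N = (\<lambda>(i, j, k). (wrap1 N i, wrap1 N j, wrap1 N k))"

definition cells :: "nat \<Rightarrow> grid_index set" where
  "cells N = {1..int N} \<times> {1..int N} \<times> {1..int N}"

definition dirs :: "grid_index set" where
  "dirs = {(1, 0, 0), (-1, 0, 0), (0, 1, 0), (0, -1, 0), (0, 0, 1), (0, 0, -1)}"

text \<open>
  Counting the unit steps that lead from \<open>p\<close> to \<open>q\<close> (rather than asking whether there is one) gives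
  the correct multiplicities also for \<open>N = 1\<close> and \<open>N = 2\<close>, where different steps lead to the same cell.
\<close>

definition grid_weight :: "real \<Rightarrow> nat \<Rightarrow> grid_index \<Rightarrow> grid_index \<Rightarrow> real" where
  "grid_weight h N p q = 1 / h\<^sup>2 * (\<Sum>e\<in>dirs. of_bool (wrap N (p + e) = q))"

definition at_index :: "grid_fun \<Rightarrow> grid_index \<Rightarrow> real" where
  "at_index v = (\<lambda>(i, j, k). v i j k)"

lemma wrap1_id: "i \<in> {1..int N} \<Longrightarrow> wrap1 N i = i"
  by (simp add: wrap1_def)

lemma wrap1_range: "N \<ge> 1 \<Longrightarrow> wrap1 N i \<in> {1..int N}"
  using pos_mod_sign[of "int N" "i - 1"] pos_mod_bound[of "int N" "i - 1"]
  unfolding wrap1_def atLeastAtMost_iff by linarith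

lemma wrap1_add: "wrap1 N (wrap1 N i + a) = wrap1 N (i + a)"
proof -
  have "((i - 1) mod int N + a) mod int N = (i - 1 + a) mod int N" by (rule mod_add_left_eq)
  then show ?thesis by (simp add: wrap1_def algebra_simps)
qed

lemma wrap_id: "p \<in> cells N \<Longrightarrow> wrap N p = p"
  by (auto simp: wrap_def cells_def wrap1_id)

lemma wrap_in_cells: "N \<ge> 1 \<Longrightarrow> wrap N p \<in> cells N"
  using wrap1_range by (auto simp: wrap_def cells_def split: prod.split)

lemma wrap_add: "wrap N (wrap N p + e) = wrap N (p + e)"
  by (cases p; cases e) (simp add: wrap_def wrap1_add)

lemma finite_dirs: "finite dirs" by (simp add: dirs_def)

lemma uminus_dirs: "uminus ` dirs = dirs" by (auto simp: dirs_def)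

lemma wrap_step_sym:
  assumes "p \<in> cells N" "q \<in> cells N"
  shows "wrap N (p + e) = q \<longleftrightarrow> wrap N (q + - e) = p"
proof -
  have "wrap N (q + - e) = p" if "wrap N (p + e) = q" "p \<in> cells N" for p q e
    using that wrap_add[of N "p + e" "- e"] wrap_id by simp
  from this[of p e q] this[of q "- e" p] show ?thesis using assms by auto
qed

lemma grid_weight_sym:
  assumes "p \<in> cells N" "q \<in> cells N"
  shows "grid_weight h N p q = grid_weight h N q p"
proof -
  have "(\<Sum>e\<in>dirs. of_bool (wrap N (q + e) = p)) = (\<Sum>e\<in>uminus ` dirs. of_bool (wrap N (q + e) = p) :: real)"
    by (simp add: uminus_dirs)
  also have "\<dots> = (\<Sum>e\<in>dirs. of_bool (wrap N (p + e) = q))"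
    by (subst sum.reindex) (auto simp: inj_on_def wrap_step_sym[OF assms])
  finally show ?thesis by (simp add: grid_weight_def)
qed

lemma grid_weight_pos:
  assumes "h > 0" "e \<in> dirs"
  shows "grid_weight h N p (wrap N (p + e)) > 0"
  unfolding grid_weight_def using assms finite_dirs
  by (intro mult_pos_pos sum_pos2[of _ e]) auto

text \<open>
  Every cell is reached from \<open>(1, 1, 1)\<close> along three axis-parallel segments that stay inside
  \<open>cells N\<close>, where no wrapping occurs; the rest is symmetry of the weights.
\<close>

lemma grid_connected:
  assumes "N \<ge> 1" "h > 0" "p \<in> cells N" "q \<in> cells N"
  shows "(p, q) \<in> {(p, q). p \<in> cells N \<and> q \<in> cells N \<and> grid_weight h N p q > 0}\<^sup>*"
    (is "_ \<in> ?E\<^sup>*")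
proof -
  have sym: "sym (?E\<^sup>*)"
    by (intro sym_rtrancl symI) (auto simp: grid_weight_sym)
  have step: "(p, p + e) \<in> ?E" if "p \<in> cells N" "p + e \<in> cells N" "e \<in> dirs" for p e
    using grid_weight_pos[OF \<open>h > 0\<close> \<open>e \<in> dirs\<close>, of N p] that by (simp add: wrap_id)
  have line: "(p, p + (i, j, k)) \<in> ?E\<^sup>*" if "(i, j, k) \<in> {(int n, 0, 0), (0, int n, 0), (0, 0, int n)}"
      "p \<in> cells N" "p + (i, j, k) \<in> cells N" for p i j k n
    using that
  proof (induction n arbitrary: i j k)
    case 0
    then show ?case by (cases p) auto
  next
    case (Suc n)
    (* (a, b, c) is the last unit step of the segment. *)
    obtain a b c where e: "(a, b, c) \<in> dirs" "(i - a, j - b, k - c) \<in> {(int n, 0, 0), (0, int n, 0), (0, 0, int n)}"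
      "a \<ge> 0" "b \<ge> 0" "c \<ge> 0" "i \<ge> a" "j \<ge> b" "k \<ge> c"
      using Suc.prems(1) by (auto simp: dirs_def)
    have mem: "p + (i - a, j - b, k - c) \<in> cells N"
      using Suc.prems(2,3) e by (cases p) (auto simp: cells_def)
    have "(p, p + (i - a, j - b, k - c)) \<in> ?E\<^sup>*"
      using Suc.IH[OF e(2) Suc.prems(2) mem] .
    moreover have "p + (i - a, j - b, k - c) + (a, b, c) = p + (i, j, k)"
      by (cases p) simp
    then have "(p + (i - a, j - b, k - c), p + (i, j, k)) \<in> ?E"
      using step[OF mem, of "(a, b, c)"] Suc.prems(3) e(1) by metis
    ultimately show ?case by (rule rtrancl_into_rtrancl)
  qed
  have origin: "((1, 1, 1), (i, j, k)) \<in> ?E\<^sup>*" if "(i, j, k) \<in> cells N" for i j k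
  proof -
    have r: "1 \<le> i" "1 \<le> j" "1 \<le> k" "i \<le> int N" "j \<le> int N" "k \<le> int N"
      using that by (auto simp: cells_def)
    have "((1, 1, 1), (1, 1, 1) + (i - 1, 0, 0)) \<in> ?E\<^sup>*"
      using r by (intro line[of _ _ _ "nat (i - 1)"]) (auto simp: cells_def)
    moreover have "((i, 1, 1), (i, 1, 1) + (0, j - 1, 0)) \<in> ?E\<^sup>*"
      using r by (intro line[of _ _ _ "nat (j - 1)"]) (auto simp: cells_def)
    moreover have "((i, j, 1), (i, j, 1) + (0, 0, k - 1)) \<in> ?E\<^sup>*"
      using r by (intro line[of _ _ _ "nat (k - 1)"]) (auto simp: cells_def)
    ultimately show ?thesis by simp
  qed
  have "((1, 1, 1), p) \<in> ?E\<^sup>*" "((1, 1, 1), q) \<in> ?E\<^sup>*"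
    using origin assms(3,4) by (cases p; cases q; simp)+
  then show ?thesis using sym by (meson rtrancl_trans symE)
qed

lemma weighted_graph_grid:
  assumes "N \<ge> 1" "h > 0"
  shows "weighted_graph (cells N) (grid_weight h N)"
proof
  show "finite (cells N)" "cells N \<noteq> {}"
    using assms(1) by (auto simp: cells_def)
qed (use assms in \<open>auto simp: grid_weight_sym grid_connected, auto simp: grid_weight_def intro!: divide_nonneg_nonneg sum_nonneg\<close>)

lemma periodic_int:
  fixes f :: "int \<Rightarrow> 'a"
  assumes "\<And>i. f (i + n) = f i"
  shows "f (i + m * n) = f i"
proof (induction m rule: int_induct[where k = 0])
  case (step1 m)
  then show ?case using assms[of "i + m * n"] by (simp add: algebra_simps)
next
  case (step2 m)
  then show ?case using assms[of "i + (m - 1) * n"] by (simp add: algebra_simps)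
qed simp

lemma periodic_wrap1:
  fixes f :: "int \<Rightarrow> 'a"
  assumes "\<And>i. f (i + int N) = f i"
  shows "f (wrap1 N i) = f i"
proof -
  have "i = wrap1 N i + (i - 1) div int N * int N"
    by (simp add: wrap1_def)
  then show ?thesis using periodic_int[of f "int N" "wrap1 N i" "(i - 1) div int N", OF assms] by simp
qed

lemma at_index_wrap:
  assumes "v \<in> C_per N"
  shows "at_index v (wrap N p) = at_index v p"
proof -
  obtain i j k where p: "p = (i, j, k)" by (cases p)
  have per: "v (i + int N) j k = v i j k" "v i (j + int N) k = v i j k" "v i j (k + int N) = v i j k" for i j k
    using assms by (auto simp: C_per_def)
  have "v (wrap1 N i) (wrap1 N j) (wrap1 N k) = v i (wrap1 N j) (wrap1 N k)"
    by (rule periodic_wrap1[of "\<lambda>i. v i (wrap1 N j) (wrap1 N k)"]) (rule per)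
  also have "\<dots> = v i j (wrap1 N k)"
    by (rule periodic_wrap1[of "\<lambda>j. v i j (wrap1 N k)"]) (rule per)
  also have "\<dots> = v i j k"
    by (rule periodic_wrap1[of "\<lambda>k. v i j k"]) (rule per)
  finally show ?thesis by (simp add: at_index_def wrap_def p)
qed

text \<open>
  The bridge to the graph: for a periodic function each of the six neighbouring values is the value
  at a wrapped cell, and the weights count those cells.
\<close>

lemma disc_laplacian_eq_lap:
  assumes "N \<ge> 1" "h > 0" "v \<in> C_per N"
  shows "disc_laplacian h v i j k =
    weighted_graph.lap (cells N) (grid_weight h N) (at_index v) (wrap N (i, j, k))"
proof -
  interpret weighted_graph "cells N" "grid_weight h N"
    using assms by (intro weighted_graph_grid)
  let ?p = "wrap N (i, j, k)" and ?v = "at_index v"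
  have "lap ?v ?p = (\<Sum>q\<in>cells N. \<Sum>e\<in>dirs. 1 / h\<^sup>2 * (of_bool (wrap N (?p + e) = q) * (?v q - ?v ?p)))"
    unfolding lap_def grid_weight_def by (simp add: sum_distrib_left sum_distrib_right mult.assoc)
  also have "\<dots> = (\<Sum>e\<in>dirs. \<Sum>q\<in>cells N. 1 / h\<^sup>2 * (of_bool (wrap N (?p + e) = q) * (?v q - ?v ?p)))"
    by (rule sum.swap)
  also have "\<dots> = (\<Sum>e\<in>dirs. 1 / h\<^sup>2 * (?v ((i, j, k) + e) - ?v (i, j, k)))"
  proof (rule sum.cong)
    fix e
    let ?z = "wrap N (?p + e)"
    have "(\<Sum>q\<in>cells N. 1 / h\<^sup>2 * (of_bool (?z = q) * (?v q - ?v ?p)))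
        = (\<Sum>q\<in>cells N. if ?z = q then 1 / h\<^sup>2 * (?v q - ?v ?p) else 0)"
      by (intro sum.cong) auto
    also have "\<dots> = 1 / h\<^sup>2 * (?v ?z - ?v ?p)"
      using finite_V wrap_in_cells[OF assms(1), of "?p + e"] by (simp add: sum.delta')
    finally have "(\<Sum>q\<in>cells N. 1 / h\<^sup>2 * (of_bool (?z = q) * (?v q - ?v ?p)))
        = 1 / h\<^sup>2 * (?v ?z - ?v ?p)" .
    then show "(\<Sum>q\<in>cells N. 1 / h\<^sup>2 * (of_bool (wrap N (?p + e) = q) * (?v q - ?v ?p)))
        = 1 / h\<^sup>2 * (?v ((i, j, k) + e) - ?v (i, j, k))"
      by (simp only: wrap_add at_index_wrap[OF assms(3)])
  qed simp
  also have "\<dots> = disc_laplacian h v i j k"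
    unfolding sum_distrib_left[symmetric]
    by (simp add: dirs_def at_index_def disc_laplacian_def)
  finally show ?thesis by simp
qed

lemma grid_mean_eq: "grid_mean L N v = mesh_size L N ^ 3 / L ^ 3 * (\<Sum>p\<in>cells N. at_index v p)"
  by (simp add: grid_mean_def cells_def at_index_def sum.cartesian_product)

definition periodic_extension :: "nat \<Rightarrow> (grid_index \<Rightarrow> real) \<Rightarrow> grid_fun" where
  "periodic_extension N f i j k = f (wrap N (i, j, k))"

lemma periodic_extension_in_C_per: "periodic_extension N f \<in> C_per N"
proof -
  have "wrap1 N (i + int N) = wrap1 N i" for i
    using mod_add_self2[of "i - 1" "int N"] by (simp add: wrap1_def algebra_simps)
  then show ?thesis by (simp add: C_per_def periodic_extension_def wrap_def)
qed

lemma at_index_periodic_extension: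
  "p \<in> cells N \<Longrightarrow> at_index (periodic_extension N f) p = f p"
  using wrap_id[of p N] by (cases p) (simp add: at_index_def periodic_extension_def)

lemma C_per_eqI:
  assumes "N \<ge> 1" "u \<in> C_per N" "v \<in> C_per N" "\<And>p. p \<in> cells N \<Longrightarrow> at_index u p = at_index v p"
  shows "u = v"
proof -
  have "at_index u p = at_index v p" for p
    using assms at_index_wrap[of u N p] at_index_wrap[of v N p] wrap_in_cells[of N p] by metis
  then show ?thesis by (auto simp: at_index_def fun_eq_iff)
qed

lemma C_per_all_iff_cells:
  assumes "N \<ge> 1"
  shows "(\<forall>i j k. Q (wrap N (i, j, k))) \<longleftrightarrow> (\<forall>p\<in>cells N. Q p)"
  using wrap_in_cells[OF assms] wrap_id[of _ N] by (metis prod_cases3)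

section \<open>Unique solvability of the scheme\<close>

theorem theorem4p1:
  fixes L \<Delta>t \<epsilon> A A\<^sub>0 M\<^sub>h \<beta>\<^sub>0 h :: real
    and N :: nat
    and \<phi>n \<phi>p :: grid_fun  \<comment> \<open>\<open>\<phi>n\<close> is the datum at step n, \<open>\<phi>p\<close> the one at step n - 1\<close>
  assumes "L > 0" and "N \<ge> 1" and "h = mesh_size L N"
    and "\<Delta>t > 0" and "\<epsilon> > 0" and "A \<ge> 0"
    and "A\<^sub>0 \<ge> 9 / 5 * (2 / 15) powr (2 / 3)"
    and "\<phi>n \<in> C_per N" and "\<phi>p \<in> C_per N"
    and "M\<^sub>h > 0" and "grid_max_norm N \<phi>n \<le> M\<^sub>h" and "grid_max_norm N \<phi>p \<le> M\<^sub>h"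
    and "grid_mean L N \<phi>n = \<beta>\<^sub>0" and "grid_mean L N \<phi>p = \<beta>\<^sub>0" and "\<beta>\<^sub>0 > 0"
  shows "\<exists>!\<phi>. \<phi> \<in> C_per N
    \<and> (\<lambda>i j k. \<phi> i j k - \<phi>n i j k) \<in> C_per_mean_zero L N
    \<and> (\<forall>i j k. \<phi> i j k > 0)
    \<and> (\<exists>\<mu> \<in> C_per N. \<forall>i j k.
          (3 / 2 * \<phi> i j k - 2 * \<phi>n i j k + 1 / 2 * \<phi>p i j k) / \<Delta>t
            = disc_laplacian h \<mu> i j k
        \<and> \<mu> i j k
            = - (8 / 3) * (\<phi> i j k powi (- 9) - \<phi> i j k powi (- 3))
              + 8 / 3 * A\<^sub>0 * (\<phi> i j k - (2 * \<phi>n i j k - \<phi>p i j k))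
              - A * \<Delta>t * disc_laplacian h (\<lambda>i j k. \<phi> i j k - \<phi>n i j k) i j k
              - \<epsilon> ^ 2 * disc_laplacian h \<phi> i j k)"
proof -
  let "\<exists>!\<phi>. ?P \<phi>" = ?thesis
  have "h > 0" using assms by (simp add: mesh_size_def)
  interpret weighted_graph "cells N" "grid_weight h N"
    using \<open>N \<ge> 1\<close> \<open>h > 0\<close> by (rule weighted_graph_grid)
  let ?n = "at_index \<phi>n" and ?p = "at_index \<phi>p"
  define \<tau> where "\<tau> = 2 / 3 * \<Delta>t"
  define \<kappa> where "\<kappa> = A * \<Delta>t + \<epsilon>\<^sup>2"
  define r where "r x = 2 / 3 * (2 * ?n x - 1 / 2 * ?p x)" for x
  (* Sorting the second scheme equation by unknowns: the extrapolated values and the old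
     Laplacian form the given linear term, the two artificial diffusions add up. *)
  define q where "q x = 8 / 3 * A\<^sub>0 * (2 * ?n x - ?p x) - A * \<Delta>t * lap ?n x" for x
  define sol where "sol f m x \<longleftrightarrow> f x > 0 \<and> f x = r x + \<tau> * lap m x
    \<and> m x = convex_force A\<^sub>0 (f x) - q x - \<kappa> * lap f x" for f m :: "grid_index \<Rightarrow> real" and x
  have \<tau>: "\<tau> > 0" and \<kappa>: "\<kappa> \<ge> 0"
    using assms by (auto simp: \<tau>_def \<kappa>_def)
  have "A\<^sub>0 \<ge> 0" using assms(7) by (smt (verit) powr_ge_zero divide_nonneg_nonneg mult_nonneg_nonneg)
  have pot_lower: "- 5 \<le> convex_potential A\<^sub>0 s" if "s > 0" for s
    using convex_potential_lower[OF that \<open>A\<^sub>0 \<ge> 0\<close>] by (smt (verit) zero_le_power2)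
  have vol: "mesh_size L N ^ 3 / L ^ 3 > 0" using assms by (simp add: mesh_size_def)
  have mass: "(\<Sum>x\<in>cells N. ?n x) > 0" "(\<Sum>x\<in>cells N. ?p x) = (\<Sum>x\<in>cells N. ?n x)"
    using assms vol unfolding grid_mean_eq by (metis zero_less_mult_pos, metis mult_cancel_left less_irrefl)
  have sum_r: "(\<Sum>x\<in>cells N. r x) = (\<Sum>x\<in>cells N. ?n x)"
    by (simp add: r_def sum_subtractf mass(2) flip: sum_distrib_left sum_divide_distrib)
  have point: "(\<phi> i j k > 0 \<and>
          (3 / 2 * \<phi> i j k - 2 * \<phi>n i j k + 1 / 2 * \<phi>p i j k) / \<Delta>t
            = disc_laplacian h \<mu> i j k
        \<and> \<mu> i j k
            = - (8 / 3) * (\<phi> i j k powi (- 9) - \<phi> i j k powi (- 3))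
              + 8 / 3 * A\<^sub>0 * (\<phi> i j k - (2 * \<phi>n i j k - \<phi>p i j k))
              - A * \<Delta>t * disc_laplacian h (\<lambda>i j k. \<phi> i j k - \<phi>n i j k) i j k
              - \<epsilon> ^ 2 * disc_laplacian h \<phi> i j k)
      \<longleftrightarrow> sol (at_index \<phi>) (at_index \<mu>) (wrap N (i, j, k))"
    if "\<phi> \<in> C_per N" "\<mu> \<in> C_per N" for \<phi> \<mu> i j k
  proof -
    have val: "v i j k = at_index v (wrap N (i, j, k))" if "v \<in> C_per N" for v i j k
      using at_index_wrap[OF that, of "(i, j, k)"] by (simp add: at_index_def)
    have diff: "(\<lambda>i j k. \<phi> i j k - \<phi>n i j k) \<in> C_per N"
      using \<open>\<phi> \<in> C_per N\<close> \<open>\<phi>n \<in> C_per N\<close> by (simp add: C_per_def)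
    have at_diff: "at_index (\<lambda>i j k. \<phi> i j k - \<phi>n i j k) = (\<lambda>x. at_index \<phi> x - ?n x)"
      by (auto simp: at_index_def)
    have *: "(3 / 2 * a - 2 * b + 1 / 2 * c) / \<Delta>t = l \<longleftrightarrow> a = 2 / 3 * (2 * b - 1 / 2 * c) + \<tau> * l"
      for a b c l
      using \<open>\<Delta>t > 0\<close> by (auto simp: \<tau>_def field_simps)
    have **: "- (8 / 3) * g + 8 / 3 * A\<^sub>0 * (a - c) - A * \<Delta>t * (l - l') - \<epsilon> ^ 2 * l =
        - (8 / 3) * g + 8 / 3 * A\<^sub>0 * a - (8 / 3 * A\<^sub>0 * c - A * \<Delta>t * l') - \<kappa> * l"
      for g a c l l'
      by (simp add: \<kappa>_def field_simps)
    show ?thesis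
      unfolding sol_def r_def q_def convex_force_def
        disc_laplacian_eq_lap[OF \<open>N \<ge> 1\<close> \<open>h > 0\<close> diff]
        disc_laplacian_eq_lap[OF \<open>N \<ge> 1\<close> \<open>h > 0\<close> \<open>\<phi> \<in> C_per N\<close>]
        disc_laplacian_eq_lap[OF \<open>N \<ge> 1\<close> \<open>h > 0\<close> \<open>\<mu> \<in> C_per N\<close>]
        at_diff lap_diff
      by (simp only: val[OF \<open>\<phi> \<in> C_per N\<close>] val[OF \<open>\<mu> \<in> C_per N\<close>]
        val[OF \<open>\<phi>n \<in> C_per N\<close>] val[OF \<open>\<phi>p \<in> C_per N\<close>] * **)
  qed
  have mean: "(\<lambda>i j k. \<phi> i j k - \<phi>n i j k) \<in> C_per_mean_zero L N"
    if "\<phi> \<in> C_per N" and sol: "\<forall>x\<in>cells N. sol (at_index \<phi>) m x" for \<phi> m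
  proof -
    have "(\<Sum>x\<in>cells N. at_index \<phi> x) = (\<Sum>x\<in>cells N. r x + \<tau> * lap m x)"
      using sol by (intro sum.cong) (auto simp: sol_def)
    then have "(\<Sum>x\<in>cells N. at_index \<phi> x) = (\<Sum>x\<in>cells N. ?n x)"
      by (simp add: sum.distrib sum_lap sum_r flip: sum_distrib_left)
    then have "(\<Sum>x\<in>cells N. at_index (\<lambda>i j k. \<phi> i j k - \<phi>n i j k) x) = 0"
      by (simp add: at_index_def case_prod_unfold sum_subtractf)
    then show ?thesis
      using \<open>\<phi> \<in> C_per N\<close> \<open>\<phi>n \<in> C_per N\<close>
      by (simp add: C_per_mean_zero_def grid_mean_eq) (simp add: C_per_def)
  qed
  (* The condition on the mean follows from the first equation, as Laplacians sum to zero. *)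
  have P_iff: "?P \<phi> \<longleftrightarrow> \<phi> \<in> C_per N \<and> (\<exists>\<mu>\<in>C_per N. \<forall>x\<in>cells N. sol (at_index \<phi>) (at_index \<mu>) x)"
    for \<phi>
    unfolding C_per_all_iff_cells[OF \<open>N \<ge> 1\<close>, symmetric]
    using point[of \<phi>] mean[of \<phi>, folded C_per_all_iff_cells[OF \<open>N \<ge> 1\<close>]] by blast
  show ?thesis
  proof (rule ex_ex1I)
    have "\<exists>f m. \<forall>x\<in>cells N. sol f m x"
      unfolding sol_def
    proof (rule implicit_step_exists)
      show "(convex_potential A\<^sub>0 has_real_derivative convex_force A\<^sub>0 s) (at s)" if "s > 0" for s
        using that by (rule convex_potential_deriv)
      show "filterlim (convex_potential A\<^sub>0) at_top (at_right 0)"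
        using \<open>A\<^sub>0 \<ge> 0\<close> by (rule convex_potential_blowup)
      show "(\<Sum>x\<in>cells N. r x) > 0"
        using sum_r mass(1) by simp
    qed (use \<tau> \<kappa> pot_lower in auto)
    then obtain f m where fm: "\<forall>x\<in>cells N. sol f m x" by blast
    define \<phi> \<mu> where "\<phi> = periodic_extension N f" and "\<mu> = periodic_extension N m"
    have ext: "at_index \<phi> x = f x" "at_index \<mu> x = m x" if "x \<in> cells N" for x
      using that by (simp_all add: \<phi>_def \<mu>_def at_index_periodic_extension)
    have sol: "\<forall>x\<in>cells N. sol (at_index \<phi>) (at_index \<mu>) x"
    proof
      fix x assume x: "x \<in> cells N"
      have laps: "lap (at_index \<phi>) x = lap f x" "lap (at_index \<mu>) x = lap m x"
        using x ext by (auto intro: lap_cong)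
      show "sol (at_index \<phi>) (at_index \<mu>) x"
        using bspec[OF fm x] unfolding sol_def ext[OF x] laps .
    qed
    have per: "\<phi> \<in> C_per N" "\<mu> \<in> C_per N"
      by (auto simp: \<phi>_def \<mu>_def periodic_extension_in_C_per)
    show "\<exists>\<phi>. ?P \<phi>"
      unfolding P_iff using per sol by blast
  next
    fix \<phi> \<phi>'
    assume "?P \<phi>" "?P \<phi>'"
    then obtain \<mu> \<mu>' where per: "\<phi> \<in> C_per N" "\<phi>' \<in> C_per N"
      and 1: "\<forall>x\<in>cells N. sol (at_index \<phi>) (at_index \<mu>) x"
      and 2: "\<forall>x\<in>cells N. sol (at_index \<phi>') (at_index \<mu>') x"
      unfolding P_iff by blast
    show "\<phi> = \<phi>'"
    proof (rule C_per_eqI[OF \<open>N \<ge> 1\<close> per])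
      fix x assume x: "x \<in> cells N"
      show "at_index \<phi> x = at_index \<phi>' x"
      proof (rule implicit_step_unique[OF \<tau> \<kappa> _ _ _ x])
        show "convex_force A\<^sub>0 s \<le> convex_force A\<^sub>0 t" if "0 < s" "s \<le> t" for s t
          using assms(7) that by (rule convex_force_mono)
      qed (use 1 2 in \<open>auto simp only: sol_def\<close>)
    qed
  qed
qed

end
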